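(* Let $\mathcal{G}=(V,(V_1,V_2,V_P),\delta)$ be a stochastic game and $T$ its set of terminal vertices. Let $\pi_2^u$ be the memoryless Player 2 strategy with $\pi_2^u(v)(v')=\frac{1}{|\mathrm{post}(v)|}$ for all $v\in V_2$ and $v'\in\mathrm{post}(v)$. Then $\mathcal{G}$ is stopping under fairness if and only if $\Pr^{\pi_1,\pi_2^u}_{\mathcal{G},v}(\Diamond T)=1$ for every $v\in V$ and every Player 1 strategy $\pi_1$.
   Context: A stochastic game is a tuple $\mathcal{G}=(V,(V_1,V_2,V_P),\delta)$ where $V$ is a finite set of vertices, $V_1,V_2,V_P$ form a partition of $V$, and $\delta:V\times V\to[0,1]$ satisfies $\delta(v,v')\in\{0,1\}$ for $v\in V_1\cup V_2$, $v'\in V$, and $\delta(v,\cdot)$ is a probability distribution on $V$ for $v\in V_P$. Let $\mathrm{post}(v)=\{v'\mid \delta(v,v')>0\}$; it is assumed $\mathrm{post}(v)\neq\emptyset$ for all $v$. A vertex $v$ is terminal if $\delta(v,v)=1$ and $\delta(v,v')=0$ for $v'\neq v$. A path is an infinite sequence $\omega=v_0v_1\dots$ with $\delta(v_k,v_{k+1})>0$ for all $k$; $\inf(\omega)$ is the set of vertices occurring infinitely often in $\omega$. A strategy for Player $i\in\{1,2\}$ is a function $\pi_i:V^*V_i\to\mathcal{D}(V)$ (probability distributions on $V$) with $\pi_i(\hat\omega u)(u')>0$ only if $u'\in\mathrm{post}(u)$; it is memoryless if $\pi_i(\hat\omega u)$ depends only on $u$. Given strategies $\pi_1,\pi_2$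 and an initial vertex $v$, $\Pr^{\pi_1,\pi_2}_{\mathcal{G},v}$ is the induced probability measure on paths starting at $v$. $\Diamond T$ is the set of paths visiting some vertex of $T$. The set of fair plays is $FP^2=\{\omega\mid \forall v'\in V_2:\ v'\in\inf(\omega)\Rightarrow \mathrm{post}(v')\subseteq\inf(\omega)\}$. A Player 2 strategy $\pi_2$ is fair if $\Pr^{\pi_1,\pi_2}_{\mathcal{G},u}(FP^2)=1$ for every Player 1 strategy $\pi_1$ and every $u\in V$. $\mathcal{G}$ is stopping under fairness if $\Pr^{\pi_1,\pi_2}_{\mathcal{G},v}(\Diamond T)=1$ for all Player 1 strategies $\pi_1$, all fair Player 2 strategies $\pi_2$, and all $v\in V$. *)

theory Defs
  imports "HOL-Probability.Probability"
begin

record 'v game =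
  verts :: "'v set"
  verts1 :: "'v set"
  verts2 :: "'v set"
  vertsP :: "'v set"
  trans_prob :: "'v \<Rightarrow> 'v \<Rightarrow> real"

text \<open>The transition function is only constrained on \<open>verts G\<close>; its values elsewhere are never used.
  The parts of the partition may be empty.\<close>

definition post :: "'v game \<Rightarrow> 'v \<Rightarrow> 'v set" where
  "post G v = {v' \<in> verts G. trans_prob G v v' > 0}"

definition stochastic_game :: "'v game \<Rightarrow> bool" where
  "stochastic_game G \<longleftrightarrow>
     finite (verts G) \<and>
     verts G = verts1 G \<union> verts2 G \<union> vertsP G \<and>
     verts1 G \<inter> verts2 G = {} \<and> verts1 G \<inter> vertsP G = {} \<and> verts2 G \<inter> vertsP G = {} \<and>
     (\<forall>v\<in>verts G. \<forall>v'\<in>verts G. 0 \<le> trans_prob G v v' \<and> trans_prob G v v' \<le> 1) \<and>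
     (\<forall>v\<in>verts1 G \<union> verts2 G. \<forall>v'\<in>verts G. trans_prob G v v' \<in> {0, 1}) \<and>
     (\<forall>v\<in>vertsP G. (\<Sum>v'\<in>verts G. trans_prob G v v') = 1) \<and>
     (\<forall>v\<in>verts G. post G v \<noteq> {})"

definition terminal :: "'v game \<Rightarrow> 'v \<Rightarrow> bool" where
  "terminal G v \<longleftrightarrow> v \<in> verts G \<and> trans_prob G v v = 1 \<and>
     (\<forall>v'\<in>verts G. v' \<noteq> v \<longrightarrow> trans_prob G v v' = 0)"

definition terminals :: "'v game \<Rightarrow> 'v set" where
  "terminals G = {v. terminal G v}"

definition paths :: "'v game \<Rightarrow> (nat \<Rightarrow> 'v) set" where
  "paths G = {\<omega>. \<forall>k. \<omega> k \<in> verts G \<and> trans_prob G (\<omega> k) (\<omega> (Suc k)) > 0}"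

definition inf_visited :: "(nat \<Rightarrow> 'v) \<Rightarrow> 'v set" where
  "inf_visited \<omega> = {v. \<exists>\<^sub>\<infinity>k. \<omega> k = v}"

definition reach :: "'v game \<Rightarrow> 'v set \<Rightarrow> (nat \<Rightarrow> 'v) set" where
  "reach G T = {\<omega> \<in> paths G. \<exists>k. \<omega> k \<in> T}"

definition fair_plays :: "'v game \<Rightarrow> (nat \<Rightarrow> 'v) set" where
  "fair_plays G = {\<omega> \<in> paths G.
     \<forall>v'\<in>verts2 G. v' \<in> inf_visited \<omega> \<longrightarrow> post G v' \<subseteq> inf_visited \<omega>}"

text \<open>A strategy maps a history and the current vertex to a distribution over the next vertex:
  \<open>\<pi> h u\<close> stands for the value of the strategy at the word \<open>h\<close> followed by \<open>u\<close>. Its values at words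
  outside \<open>V\<^sup>*V\<^sub>i\<close> are unconstrained and never used.\<close>

type_synonym 'v strategy = "'v list \<Rightarrow> 'v \<Rightarrow> 'v pmf"

definition strategy_on :: "'v game \<Rightarrow> 'v set \<Rightarrow> 'v strategy \<Rightarrow> bool" where
  "strategy_on G U \<pi> \<longleftrightarrow> (\<forall>h\<in>lists (verts G). \<forall>u\<in>U. set_pmf (\<pi> h u) \<subseteq> post G u)"

definition strategies1 :: "'v game \<Rightarrow> 'v strategy set" where
  "strategies1 G = {\<pi>. strategy_on G (verts1 G) \<pi>}"

definition strategies2 :: "'v game \<Rightarrow> 'v strategy set" where
  "strategies2 G = {\<pi>. strategy_on G (verts2 G) \<pi>}"

definition memoryless :: "'v game \<Rightarrow> 'v set \<Rightarrow> 'v strategy \<Rightarrow> bool" where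
  "memoryless G U \<pi> \<longleftrightarrow>
     (\<forall>h\<in>lists (verts G). \<forall>h'\<in>lists (verts G). \<forall>u\<in>U. \<pi> h u = \<pi> h' u)"

definition uniform_strategy :: "'v game \<Rightarrow> 'v strategy" where
  "uniform_strategy G h v = pmf_of_set (post G v)"

definition step_pmf :: "'v game \<Rightarrow> 'v strategy \<Rightarrow> 'v strategy \<Rightarrow> 'v list \<Rightarrow> 'v \<Rightarrow> 'v pmf" where
  "step_pmf G \<pi>\<^sub>1 \<pi>\<^sub>2 h u =
     (if u \<in> verts1 G then \<pi>\<^sub>1 h u
      else if u \<in> verts2 G then \<pi>\<^sub>2 h u
      else embed_pmf (\<lambda>v'. if v' \<in> verts G then trans_prob G u v' else 0))"

text \<open>The distribution of the vertex at position \<open>n\<close> given the vertices \<open>\<omega> i\<close> for \<open>i < n\<close>.\<close>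

definition vertex_pmf ::
    "'v game \<Rightarrow> 'v strategy \<Rightarrow> 'v strategy \<Rightarrow> 'v \<Rightarrow> nat \<Rightarrow> (nat \<Rightarrow> 'v) \<Rightarrow> 'v pmf" where
  "vertex_pmf G \<pi>\<^sub>1 \<pi>\<^sub>2 v n \<omega> =
     (case n of 0 \<Rightarrow> return_pmf v | Suc m \<Rightarrow> step_pmf G \<pi>\<^sub>1 \<pi>\<^sub>2 (map \<omega> [0..<m]) (\<omega> m))"

text \<open>Restricting the sample space to the finite set \<open>verts G\<close> makes every history-dependent kernel
  measurable, whatever the cardinality of the type of vertices.\<close>

definition vertex_kernel ::
    "'v game \<Rightarrow> 'v strategy \<Rightarrow> 'v strategy \<Rightarrow> 'v \<Rightarrow> nat \<Rightarrow> (nat \<Rightarrow> 'v) \<Rightarrow> 'v measure" where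
  "vertex_kernel G \<pi>\<^sub>1 \<pi>\<^sub>2 v n \<omega> =
     restrict_space (measure_pmf (vertex_pmf G \<pi>\<^sub>1 \<pi>\<^sub>2 v n \<omega>)) (verts G)"

text \<open>The measure on infinite sequences obtained from these kernels by the Ionescu-Tulcea theorem;
  the lemmas at the end of this theory show that it is a probability measure with the expected values
  on cylinders.\<close>

definition path_measure ::
    "'v game \<Rightarrow> 'v strategy \<Rightarrow> 'v strategy \<Rightarrow> 'v \<Rightarrow> (nat \<Rightarrow> 'v) measure" where
  "path_measure G \<pi>\<^sub>1 \<pi>\<^sub>2 v =
     projective_family.lim UNIV
       (Ionescu_Tulcea.CI (vertex_kernel G \<pi>\<^sub>1 \<pi>\<^sub>2 v) (\<lambda>_. count_space (verts G)))
       (\<lambda>_. count_space (verts G))"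

definition fair_strategies2 :: "'v game \<Rightarrow> 'v strategy set" where
  "fair_strategies2 G = {\<pi>\<^sub>2 \<in> strategies2 G.
     \<forall>\<pi>\<^sub>1\<in>strategies1 G. \<forall>u\<in>verts G. measure (path_measure G \<pi>\<^sub>1 \<pi>\<^sub>2 u) (fair_plays G) = 1}"

definition stopping_under_fairness :: "'v game \<Rightarrow> bool" where
  "stopping_under_fairness G \<longleftrightarrow>
     (\<forall>\<pi>\<^sub>1\<in>strategies1 G. \<forall>\<pi>\<^sub>2\<in>fair_strategies2 G. \<forall>v\<in>verts G.
        measure (path_measure G \<pi>\<^sub>1 \<pi>\<^sub>2 v) (reach G (terminals G)) = 1)"

lemma finite_verts: "stochastic_game G \<Longrightarrow> finite (verts G)"
  unfolding stochastic_game_def by blast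

lemma finite_post: "stochastic_game G \<Longrightarrow> finite (post G v)"
  using finite_verts[of G] by (simp add: post_def)

lemma post_subset: "post G v \<subseteq> verts G"
  by (auto simp: post_def)

lemma uniform_strategy:
  assumes "stochastic_game G"
  shows "uniform_strategy G \<in> strategies2 G"
    and "memoryless G (verts2 G) (uniform_strategy G)"
    and "v \<in> verts2 G \<Longrightarrow> v' \<in> post G v \<Longrightarrow> pmf (uniform_strategy G h v) v' = 1 / card (post G v)"
proof -
  have ne: "post G v \<noteq> {}" if "v \<in> verts2 G" for v
    using assms that by (auto simp: stochastic_game_def)
  show "uniform_strategy G \<in> strategies2 G"
    using ne finite_post[OF assms] by (simp add: strategies2_def strategy_on_def uniform_strategy_def)
  show "memoryless G (verts2 G) (uniform_strategy G)"
    by (simp add: memoryless_def uniform_strategy_def)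
  show "v \<in> verts2 G \<Longrightarrow> v' \<in> post G v \<Longrightarrow> pmf (uniform_strategy G h v) v' = 1 / card (post G v)"
    using ne finite_post[OF assms] by (simp add: uniform_strategy_def)
qed

lemma pmf_step_vertsP:
  assumes G: "stochastic_game G" and u: "u \<in> vertsP G"
  shows "pmf (step_pmf G \<pi>\<^sub>1 \<pi>\<^sub>2 h u) v' = (if v' \<in> verts G then trans_prob G u v' else 0)"
proof -
  let ?f = "\<lambda>v'. if v' \<in> verts G then trans_prob G u v' else 0"
  have uV: "u \<in> verts G" and n12: "u \<notin> verts1 G" "u \<notin> verts2 G" and fin: "finite (verts G)"
    and one: "(\<Sum>v'\<in>verts G. trans_prob G u v') = 1"
    using G u finite_verts[OF G] unfolding stochastic_game_def by blast+
  have nn: "0 \<le> ?f x" for x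
    using G uV by (auto simp: stochastic_game_def)
  have "(\<integral>\<^sup>+x. ennreal (?f x) \<partial>count_space UNIV) = (\<Sum>x\<in>verts G. ennreal (?f x))"
    using fin by (intro nn_integral_count_space') auto
  also have "\<dots> = ennreal (\<Sum>x\<in>verts G. ?f x)"
    using nn by (rule sum_ennreal)
  also have "\<dots> = 1"
    using one by simp
  finally have "(\<integral>\<^sup>+x. ennreal (?f x) \<partial>count_space UNIV) = 1" .
  then show ?thesis
    using nn n12 by (simp add: step_pmf_def pmf_embed_pmf)
qed

lemma set_pmf_step:
  assumes G: "stochastic_game G" and \<pi>\<^sub>1: "\<pi>\<^sub>1 \<in> strategies1 G" and \<pi>\<^sub>2: "\<pi>\<^sub>2 \<in> strategies2 G"
    and h: "h \<in> lists (verts G)" and u: "u \<in> verts G"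
  shows "set_pmf (step_pmf G \<pi>\<^sub>1 \<pi>\<^sub>2 h u) \<subseteq> post G u"
proof -
  consider "u \<in> verts1 G" | "u \<notin> verts1 G" "u \<in> verts2 G" | "u \<in> vertsP G"
    using G u by (auto simp: stochastic_game_def)
  then show ?thesis
  proof cases
    case 1
    then show ?thesis
      using \<pi>\<^sub>1 h by (auto simp: step_pmf_def strategies1_def strategy_on_def)
  next
    case 2
    then show ?thesis
      using \<pi>\<^sub>2 h by (auto simp: step_pmf_def strategies2_def strategy_on_def)
  next
    case 3
    have "0 \<le> trans_prob G u v'" if "v' \<in> verts G" for v'
      using G u that by (auto simp: stochastic_game_def)
    then show ?thesis
      using pmf_step_vertsP[OF G 3]
      by (force simp: set_pmf_iff post_def split: if_splits)
  qed
qed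

lemma set_vertex_pmf:
  assumes "stochastic_game G" "\<pi>\<^sub>1 \<in> strategies1 G" "\<pi>\<^sub>2 \<in> strategies2 G" "v \<in> verts G"
    and "\<And>i. i < n \<Longrightarrow> \<omega> i \<in> verts G"
  shows "set_pmf (vertex_pmf G \<pi>\<^sub>1 \<pi>\<^sub>2 v n \<omega>) \<subseteq> verts G"
proof (cases n)
  case 0
  then show ?thesis using assms by (simp add: vertex_pmf_def)
next
  case (Suc m)
  then have "set_pmf (step_pmf G \<pi>\<^sub>1 \<pi>\<^sub>2 (map \<omega> [0..<m]) (\<omega> m)) \<subseteq> post G (\<omega> m)"
    using assms by (intro set_pmf_step) auto
  then show ?thesis
    using Suc post_subset[of G "\<omega> m"] by (auto simp: vertex_pmf_def)
qed

lemma Ionescu_Tulcea_vertex_kernel: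
  assumes G: "stochastic_game G" and s: "\<pi>\<^sub>1 \<in> strategies1 G" "\<pi>\<^sub>2 \<in> strategies2 G" "v \<in> verts G"
  shows "Ionescu_Tulcea (vertex_kernel G \<pi>\<^sub>1 \<pi>\<^sub>2 v) (\<lambda>_. count_space (verts G))"
proof (rule Ionescu_Tulcea.intro)
  fix n :: nat
  have fin: "finite (verts G)"
    using G by (rule finite_verts)
  let ?H = "PiM {0..<n} (\<lambda>_. count_space (verts G))"
  have H: "?H = count_space ({0..<n} \<rightarrow>\<^sub>E verts G)"
    using fin by (intro count_space_PiM_finite) (auto intro: countable_finite)
  have prob: "prob_space (vertex_kernel G \<pi>\<^sub>1 \<pi>\<^sub>2 v n \<omega>)" if "\<omega> \<in> space ?H" for \<omega>
  proof -
    have "set_pmf (vertex_pmf G \<pi>\<^sub>1 \<pi>\<^sub>2 v n \<omega>) \<subseteq> verts G"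
      using that by (intro set_vertex_pmf[OF G s]) (auto simp: space_PiM)
    then have "emeasure (measure_pmf (vertex_pmf G \<pi>\<^sub>1 \<pi>\<^sub>2 v n \<omega>)) (verts G) = 1"
      by (auto simp: measure_pmf.emeasure_eq_measure measure_pmf.prob_eq_1 AE_measure_pmf_iff)
    then show ?thesis
      unfolding vertex_kernel_def
      by (intro prob_spaceI) (simp add: emeasure_restrict_space space_restrict_space)
  qed
  have sets: "sets (vertex_kernel G \<pi>\<^sub>1 \<pi>\<^sub>2 v n \<omega>) = sets (count_space (verts G))" for \<omega>
    by (auto simp: vertex_kernel_def sets_restrict_space)
  show "vertex_kernel G \<pi>\<^sub>1 \<pi>\<^sub>2 v n \<in> measurable ?H (subprob_algebra (count_space (verts G)))"
    using prob sets unfolding H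
    by (auto simp: space_subprob_algebra intro: prob_space_imp_subprob_space)
  show "prob_space (vertex_kernel G \<pi>\<^sub>1 \<pi>\<^sub>2 v n \<omega>)" if "\<omega> \<in> space ?H" for \<omega>
    using that by (rule prob)
qed

lemma prob_space_path_measure:
  assumes "stochastic_game G" "\<pi>\<^sub>1 \<in> strategies1 G" "\<pi>\<^sub>2 \<in> strategies2 G" "v \<in> verts G"
  shows "prob_space (path_measure G \<pi>\<^sub>1 \<pi>\<^sub>2 v)"
    and "sets (path_measure G \<pi>\<^sub>1 \<pi>\<^sub>2 v) = sets (PiM UNIV (\<lambda>_. count_space (verts G)))"
    and "space (path_measure G \<pi>\<^sub>1 \<pi>\<^sub>2 v) = UNIV \<rightarrow>\<^sub>E verts G"
proof -
  interpret Ionescu_Tulcea "vertex_kernel G \<pi>\<^sub>1 \<pi>\<^sub>2 v" "\<lambda>_. count_space (verts G)"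
    by (rule Ionescu_Tulcea_vertex_kernel[OF assms])
  have e: "path_measure G \<pi>\<^sub>1 \<pi>\<^sub>2 v = PF.lim"
    by (simp add: path_measure_def)
  have "emeasure PF.lim (PF.emb UNIV {} (space (PiM {} (\<lambda>_. count_space (verts G))))) = 
        emeasure (CI {}) (space (PiM {} (\<lambda>_. count_space (verts G))))"
    by (intro lim) auto
  also have "\<dots> = 1"
    using PF.prob_space_P[of "{}"] PF.sets_P[of "{}"]
    by (metis finite.emptyI prob_space.emeasure_space_1 sets_eq_imp_space_eq subset_UNIV)
  also have "PF.emb UNIV {} (space (PiM {} (\<lambda>_. count_space (verts G)))) = space PF.lim"
    by (auto simp: prod_emb_def space_PiM)
  finally show "prob_space (path_measure G \<pi>\<^sub>1 \<pi>\<^sub>2 v)"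
    unfolding e by (rule prob_spaceI)
  show "sets (path_measure G \<pi>\<^sub>1 \<pi>\<^sub>2 v) = sets (PiM UNIV (\<lambda>_. count_space (verts G)))"
    unfolding e by simp
  show "space (path_measure G \<pi>\<^sub>1 \<pi>\<^sub>2 v) = UNIV \<rightarrow>\<^sub>E verts G"
    unfolding e by (simp add: space_PiM)
qed

lemma measure_path_measure_cylinder:
  assumes G: "stochastic_game G" and s: "\<pi>\<^sub>1 \<in> strategies1 G" "\<pi>\<^sub>2 \<in> strategies2 G" "v \<in> verts G"
    and x: "\<And>i. i < n \<Longrightarrow> x i \<in> verts G"
  shows "measure (path_measure G \<pi>\<^sub>1 \<pi>\<^sub>2 v) {\<omega> \<in> UNIV \<rightarrow>\<^sub>E verts G. \<forall>i<n. \<omega> i = x i} =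
     (\<Prod>i<n. pmf (vertex_pmf G \<pi>\<^sub>1 \<pi>\<^sub>2 v i x) (x i))"
proof -
  let ?M = "\<lambda>_::nat. count_space (verts G)"
  interpret Ionescu_Tulcea "vertex_kernel G \<pi>\<^sub>1 \<pi>\<^sub>2 v" ?M
    by (rule Ionescu_Tulcea_vertex_kernel[OF G s])
  have fin: "finite (verts G)"
    using G by (rule finite_verts)
  have H: "PiM {0..<m} ?M = count_space ({0..<m} \<rightarrow>\<^sub>E verts G)" for m
    using fin by (intro count_space_PiM_finite) (auto intro: countable_finite)
  have cyl: "restrict x {0..<m} \<in> {0..<m} \<rightarrow>\<^sub>E verts G" if "m \<le> n" for m
    using x that by auto
  have vp: "vertex_pmf G \<pi>\<^sub>1 \<pi>\<^sub>2 v m (restrict x {0..<m}) = vertex_pmf G \<pi>\<^sub>1 \<pi>\<^sub>2 v m x" for m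
    by (auto simp: vertex_pmf_def split: nat.splits intro!: arg_cong2[where f="step_pmf G \<pi>\<^sub>1 \<pi>\<^sub>2"])
  have C: "emeasure (C 0 m (\<lambda>_. undefined)) {restrict x {0..<m}} =
      (\<Prod>i<m. ennreal (pmf (vertex_pmf G \<pi>\<^sub>1 \<pi>\<^sub>2 v i x) (x i)))" if "m \<le> n" for m
    using that
  proof (induction m)
    case 0
    have "(\<lambda>_. undefined) = restrict x {0..<0}" by auto
    then show ?case by (simp add: PiM_empty)
  next
    case (Suc m)
    let ?A = "{restrict x {0..<Suc m}}"
    have A: "?A \<in> sets (PiM {0..<Suc m} ?M)"
      unfolding H using cyl[OF Suc.prems] by auto
    have u: "(\<lambda>_. undefined) \<in> space (PiM {0..<0::nat} ?M)" by (simp add: space_PiM)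
    have sp: "space (C 0 m (\<lambda>_. undefined)) = {0..<m} \<rightarrow>\<^sub>E verts G"
      using space_C[OF u, of m] by (simp add: space_PiM)
    have st: "sets (C 0 m (\<lambda>_. undefined)) = sets (PiM {0..<m} ?M)"
      using sets_C[OF u, of m] by simp
    have ne: "space (C 0 m (\<lambda>_. undefined)) \<noteq> {}"
      unfolding sp using cyl[of m] Suc.prems by (metis Suc_leD empty_iff)
    have "emeasure (C 0 (Suc m) (\<lambda>_. undefined)) ?A =
      (\<integral>\<^sup>+ y. emeasure (eP m y) ?A \<partial>C 0 m (\<lambda>_. undefined))"
      using A measurable_eP[of m] ne
      by (subst C.simps, subst emeasure_bind[where N="PiM {0..<Suc m} ?M"])
         (simp_all add: measurable_cong_sets[OF st refl])
    also have "\<dots> = (\<integral>\<^sup>+ y. ennreal (pmf (vertex_pmf G \<pi>\<^sub>1 \<pi>\<^sub>2 v m x) (x m)) *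
        indicator {restrict x {0..<m}} y \<partial>C 0 m (\<lambda>_. undefined))"
    proof (rule nn_integral_cong)
      fix y assume "y \<in> space (C 0 m (\<lambda>_. undefined))"
      then have y: "y \<in> {0..<m} \<rightarrow>\<^sub>E verts G" by (simp add: sp)
      have xm: "x m \<in> verts G" using Suc.prems x by simp
      have "emeasure (eP m y) ?A =
          vertex_kernel G \<pi>\<^sub>1 \<pi>\<^sub>2 v m y ((\<lambda>z. y(m := z)) -` ?A \<inter> verts G)"
        using emeasure_eP[OF _ A, of y] y by (simp add: space_PiM)
      also have "(\<lambda>z. y(m := z)) -` ?A \<inter> verts G = (if y = restrict x {0..<m} then {x m} else {})"
      proof -
        have key: "y(m := z) = restrict x {0..<Suc m} \<longleftrightarrow> y = restrict x {0..<m} \<and> z = x m" for z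
        proof
          assume a: "y(m := z) = restrict x {0..<Suc m}"
          have "z = x m" using fun_cong[OF a, of m] by simp
          moreover have "y i = restrict x {0..<m} i" for i
            using fun_cong[OF a, of i] y
            by (cases "i < m"; cases "i = m") (auto simp: PiE_def extensional_def)
          ultimately show "y = restrict x {0..<m} \<and> z = x m" by auto
        qed (auto simp: fun_eq_iff restrict_def)
        show ?thesis unfolding vimage_def singleton_iff key using xm by auto
      qed
      also have "vertex_kernel G \<pi>\<^sub>1 \<pi>\<^sub>2 v m y \<dots> =
        ennreal (pmf (vertex_pmf G \<pi>\<^sub>1 \<pi>\<^sub>2 v m x) (x m)) * indicator {restrict x {0..<m}} y"
        using xm vp[of m]
        by (auto simp: vertex_kernel_def emeasure_restrict_space emeasure_pmf_single)
      finally show "emeasure (eP m y) ?A =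
        ennreal (pmf (vertex_pmf G \<pi>\<^sub>1 \<pi>\<^sub>2 v m x) (x m)) * indicator {restrict x {0..<m}} y" .
    qed
    also have "\<dots> = ennreal (pmf (vertex_pmf G \<pi>\<^sub>1 \<pi>\<^sub>2 v m x) (x m)) *
        emeasure (C 0 m (\<lambda>_. undefined)) {restrict x {0..<m}}"
      using cyl[of m] Suc.prems by (intro nn_integral_cmult_indicator) (simp add: st H)
    finally show ?case
      by (simp only: Suc.IH[OF Suc_leD[OF Suc.prems]] prod.lessThan_Suc mult.commute)
  qed
  have S: "{restrict x {0..<n}} \<in> sets (PiM {0..<n} ?M)"
    unfolding H using cyl[of n] by auto
  have "{\<omega> \<in> UNIV \<rightarrow>\<^sub>E verts G. \<forall>i<n. \<omega> i = x i} = PF.emb UNIV {0..<n} {restrict x {0..<n}}"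
  proof -
    have "(\<forall>i<n. \<omega> i = x i) \<longleftrightarrow> restrict \<omega> {0..<n} = restrict x {0..<n}" for \<omega>
      by (auto simp: restrict_def fun_eq_iff)
    then show ?thesis
      by (auto simp: prod_emb_def PiE_iff)
  qed
  then have "emeasure (path_measure G \<pi>\<^sub>1 \<pi>\<^sub>2 v) {\<omega> \<in> UNIV \<rightarrow>\<^sub>E verts G. \<forall>i<n. \<omega> i = x i} =
      emeasure (CI {0..<n}) {restrict x {0..<n}}"
    using lim[OF _ S] by (simp add: path_measure_def)
  also have "\<dots> = emeasure (C 0 n (\<lambda>_. undefined)) {restrict x {0..<n}}"
  proof -
    have "{restrict x {0..<n}} \<subseteq> (\<Pi>\<^sub>E i\<in>{0..<n}. space (?M i))"
      using cyl[OF order_refl] by (simp only: space_count_space insert_subset empty_subsetI simp_thms)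
    then show ?thesis
      using emeasure_CI[OF order_refl S] by (simp only: prod_emb_id)
  qed
  also have "\<dots> = ennreal (\<Prod>i<n. pmf (vertex_pmf G \<pi>\<^sub>1 \<pi>\<^sub>2 v i x) (x i))"
    by (simp add: C prod_ennreal)
  finally show ?thesis
    by (simp add: measure_def prod_nonneg)
qed

end

theory Submission
  imports Defs
begin

text \<open>The key fact is that a vertex which is chosen with probability at least \<open>p > 0\<close> at every visit
  to \<open>w\<close> is almost surely seen infinitely often if \<open>w\<close> is. Hence the uniform strategy is fair, which
  gives one direction. For the other one, if \<open>T\<close> is reached almost surely against the uniform
  strategy, then every vertex belongs to the attractor of \<open>T\<close> in which Player 2 and the probabilistic
  vertices cooperate; otherwise Player 1 could stay outside the attractor forever. Against a fair
  strategy almost every play is fair to the vertices of Player 2 and to the probabilistic ones, and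
  rule induction on the attractor shows that such a play visits \<open>T\<close>.\<close>

section \<open>Measurability of events on the path space\<close>

locale game_play =
  fixes G :: "'v game" and \<pi>\<^sub>1 \<pi>\<^sub>2 :: "'v strategy" and v :: 'v
  assumes game: "stochastic_game G" and s1: "\<pi>\<^sub>1 \<in> strategies1 G" and s2: "\<pi>\<^sub>2 \<in> strategies2 G"
    and init: "v \<in> verts G"
begin

abbreviation M :: "(nat \<Rightarrow> 'v) measure" where
  "M \<equiv> path_measure G \<pi>\<^sub>1 \<pi>\<^sub>2 v"

sublocale prob_space M
  using prob_space_path_measure(1)[OF game s1 s2 init] .

lemma space_M: "space M = UNIV \<rightarrow>\<^sub>E verts G"
  using prob_space_path_measure(3)[OF game s1 s2 init] .

lemma space_M_iff: "\<omega> \<in> space M \<longleftrightarrow> (\<forall>k. \<omega> k \<in> verts G)"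
  by (auto simp: space_M)

lemma prefix_eq_iff: "length xs = n \<Longrightarrow> map \<omega> [0..<n] = xs \<longleftrightarrow> (\<forall>i<n. \<omega> i = xs ! i)"
  by (auto simp: list_eq_iff_nth_eq)

lemma measurable_coordinate: "(\<lambda>\<omega>. \<omega> k) \<in> M \<rightarrow>\<^sub>M count_space (verts G)"
  using measurable_component_singleton[of k UNIV "\<lambda>_. count_space (verts G)"]
  by (simp add: measurable_cong_sets[OF prob_space_path_measure(2)[OF game s1 s2 init] refl])

lemma measurable_coordinate_eq: "{\<omega> \<in> space M. \<omega> k = a} \<in> sets M"
proof -
  have "{\<omega> \<in> space M. \<omega> k = a} = (\<lambda>\<omega>. \<omega> k) -` ({a} \<inter> verts G) \<inter> space M"
    by (auto simp: space_M)
  also have "\<dots> \<in> sets M"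
    by (rule measurable_sets[OF measurable_coordinate]) simp
  finally show ?thesis .
qed

text \<open>Since \<open>verts G\<close> is finite, a prefix of fixed length takes only finitely
  many values on \<open>space M\<close>, so it is measurable even into the full power set. Every
  property of finitely many coordinates becomes measurable in this way.\<close>

lemma measurable_prefix: "(\<lambda>\<omega>. map \<omega> [0..<n]) \<in> M \<rightarrow>\<^sub>M count_space UNIV"
proof -
  have fin: "finite {xs. set xs \<subseteq> verts G \<and> length xs = n}"
    using finite_lists_length_eq[OF finite_verts[OF game]] .
  have single: "{\<omega> \<in> space M. map \<omega> [0..<n] = xs} \<in> sets M" for xs
  proof (cases "length xs = n")
    case True
    have "{\<omega> \<in> space M. \<forall>i\<in>{..<n}. \<omega> i = xs ! i} \<in> sets M"
      by (rule sets.sets_Collect_finite_All) (auto intro: measurable_coordinate_eq)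
    then show ?thesis
      by (simp only: prefix_eq_iff[OF True] Ball_def lessThan_iff)
  next
    case False
    then have "map \<omega> [0..<n] \<noteq> xs" for \<omega> by (metis length_map length_upt diff_zero)
    then have "{\<omega> \<in> space M. map \<omega> [0..<n] = xs} = {}" by blast
    then show ?thesis by (simp only: sets.empty_sets)
  qed
  show ?thesis
  proof (rule measurableI)
    fix A :: "'v list set"
    have "(\<lambda>\<omega>. map \<omega> [0..<n]) -` A \<inter> space M =
      (\<Union>xs\<in>A \<inter> {xs. set xs \<subseteq> verts G \<and> length xs = n}. {\<omega> \<in> space M. map \<omega> [0..<n] = xs})"
      (is "?L = ?R")
    proof
      show "?L \<subseteq> ?R"
      proof
        fix \<omega> assume "\<omega> \<in> ?L"
        then have "map \<omega> [0..<n] \<in> A" "\<omega> \<in> space M" by blast+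
        moreover from this have "set (map \<omega> [0..<n]) \<subseteq> verts G" by (auto simp: space_M_iff)
        ultimately show "\<omega> \<in> ?R" by simp
      qed
    qed blast
    also have "\<dots> \<in> sets M"
      using fin by (intro sets.finite_UN single) simp
    finally show "(\<lambda>\<omega>. map \<omega> [0..<n]) -` A \<inter> space M \<in> sets M" .
  qed simp
qed

lemma measurable_pred_step: "Measurable.pred M (\<lambda>\<omega>. P (\<omega> k) (\<omega> (Suc k)))"
proof -
  have "(\<lambda>xs. P (xs ! k) (xs ! Suc k)) \<circ> (\<lambda>\<omega>. map \<omega> [0..<Suc (Suc k)]) \<in> M \<rightarrow>\<^sub>M count_space UNIV"
    by (rule measurable_comp[OF measurable_prefix]) simp
  then show ?thesis
    by (simp add: comp_def nth_append)
qed

lemma measurable_paths: "Measurable.pred M (\<lambda>\<omega>. \<omega> \<in> paths G)"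
  unfolding paths_def mem_Collect_eq
  by (intro pred_intros_countable(1)
      measurable_pred_step[of "\<lambda>a b. a \<in> verts G \<and> trans_prob G a b > 0"])

lemma paths_subset_space: "paths G \<subseteq> space M"
  by (auto simp: paths_def space_M)

lemma sets_reach: "reach G T \<in> sets M"
proof -
  have "Measurable.pred M (\<lambda>\<omega>. \<omega> \<in> paths G \<and> (\<exists>k. \<omega> k \<in> T))"
    by (intro pred_intros_logic(3) measurable_paths pred_intros_countable(2)
        measurable_pred_step[of "\<lambda>a b. a \<in> T"])
  then have "{\<omega> \<in> space M. \<omega> \<in> paths G \<and> (\<exists>k. \<omega> k \<in> T)} \<in> sets M"
    by (rule predE)
  also have "{\<omega> \<in> space M. \<omega> \<in> paths G \<and> (\<exists>k. \<omega> k \<in> T)} = reach G T"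
    using paths_subset_space by (auto simp: reach_def)
  finally show ?thesis .
qed


section \<open>Laws of finite prefixes as discrete distributions\<close>

text \<open>The law of the first \<open>n + 1\<close> vertices, the initial one included. With
  \<open>distr_prefix\<close>, the recursion turns expectations over \<open>M\<close> into nested
  expectations over single moves; \<open>butlast\<close> and \<open>last\<close> split a word into
  the history and the current vertex that a strategy expects.\<close>

primrec word_pmf :: "nat \<Rightarrow> 'v list pmf" where
  "word_pmf 0 = return_pmf [v]"
| "word_pmf (Suc n) = bind_pmf (word_pmf n)
     (\<lambda>xs. map_pmf (\<lambda>x. xs @ [x]) (step_pmf G \<pi>\<^sub>1 \<pi>\<^sub>2 (butlast xs) (last xs)))"

lemma set_word_pmf: "xs \<in> set_pmf (word_pmf n) \<Longrightarrow> length xs = Suc n \<and> set xs \<subseteq> verts G"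
proof (induction n arbitrary: xs)
  case 0
  then show ?case using init by simp
next
  case (Suc n)
  then obtain ys y where xs: "xs = ys @ [y]" and ys: "ys \<in> set_pmf (word_pmf n)"
    and y: "y \<in> set_pmf (step_pmf G \<pi>\<^sub>1 \<pi>\<^sub>2 (butlast ys) (last ys))"
    by auto
  have len: "length ys = Suc n" and V: "set ys \<subseteq> verts G"
    using Suc.IH[OF ys] by auto
  have "ys \<noteq> []" using len by auto
  then have "last ys \<in> verts G" "butlast ys \<in> lists (verts G)"
    using V last_in_set[of ys] by (auto dest: in_set_butlastD)
  then have "y \<in> verts G"
    using y set_pmf_step[OF game s1 s2] post_subset by fast
  with xs len V show ?case by simp
qed

lemma vertex_pmf_cong:
  "(\<And>j. j < i \<Longrightarrow> x j = y j) \<Longrightarrow> vertex_pmf G \<pi>\<^sub>1 \<pi>\<^sub>2 v i x = vertex_pmf G \<pi>\<^sub>1 \<pi>\<^sub>2 v i y"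
  by (auto simp: vertex_pmf_def split: nat.splits intro!: arg_cong2[where f="step_pmf G \<pi>\<^sub>1 \<pi>\<^sub>2"])

text \<open>The chain rule, in the form of the cylinder formula for \<open>path_measure\<close>.
  Using \<open>(!) xs\<close> as an infinite sequence is harmless: \<open>vertex_pmf\<close> at
  \<open>i\<close> reads only positions below \<open>i\<close>, all of them inside the word.\<close>

lemma pmf_word_pmf:
  "length xs = Suc n \<Longrightarrow>
    pmf (word_pmf n) xs = (\<Prod>i<Suc n. pmf (vertex_pmf G \<pi>\<^sub>1 \<pi>\<^sub>2 v i ((!) xs)) (xs ! i))"
proof (induction n arbitrary: xs)
  case 0
  then obtain x where "xs = [x]" by (auto simp: length_Suc_conv)
  then show ?case by (simp add: vertex_pmf_def indicator_def)
next
  case (Suc n)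
  then obtain ys y where xs: "xs = ys @ [y]" and len: "length ys = Suc n"
    by (cases xs rule: rev_cases) auto
  let ?D = "\<lambda>zs. step_pmf G \<pi>\<^sub>1 \<pi>\<^sub>2 (butlast zs) (last zs)"
  have vim: "(\<lambda>x. zs @ [x]) -` {ys @ [y]} = (if zs = ys then {y} else {})" for zs
    by auto
  have "pmf (map_pmf (\<lambda>x. zs @ [x]) (?D zs)) xs = pmf (?D ys) y * indicator {ys} zs" for zs
    by (simp add: xs pmf_map vim measure_pmf_single)
  then have "pmf (word_pmf (Suc n)) xs = pmf (?D ys) y * pmf (word_pmf n) ys"
    by (simp add: pmf_bind measure_pmf_single)
  moreover have "vertex_pmf G \<pi>\<^sub>1 \<pi>\<^sub>2 v (Suc n) ((!) xs) = ?D ys"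
  proof -
    have "map ((!) xs) [0..<n] = butlast ys"
      by (rule nth_equalityI) (auto simp: len xs nth_append nth_butlast)
    moreover have "xs ! n = last ys"
      using len by (subst last_conv_nth) (auto simp: xs nth_append)
    ultimately show ?thesis by (simp add: vertex_pmf_def)
  qed
  moreover have "vertex_pmf G \<pi>\<^sub>1 \<pi>\<^sub>2 v i ((!) xs) = vertex_pmf G \<pi>\<^sub>1 \<pi>\<^sub>2 v i ((!) ys)" "xs ! i = ys ! i"
    if "i < Suc n" for i
    using that by (auto simp: xs nth_append len intro: vertex_pmf_cong)
  ultimately show ?case
    by (subst prod.lessThan_Suc) (simp add: Suc.IH[OF len] xs len nth_append del: prod.lessThan_Suc)
qed

text \<open>Both measures are concentrated on the finite set of words of length \<open>n + 1\<close>
  over \<open>verts G\<close>, so it suffices to compare point masses; the mass of a word is that of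
  its cylinder.\<close>

lemma distr_prefix:
  "distr M (count_space UNIV) (\<lambda>\<omega>. map \<omega> [0..<Suc n]) = measure_pmf (word_pmf n)"
proof (rule measure_eqI_countable_AE)
  let ?W = "{xs. set xs \<subseteq> verts G \<and> length xs = Suc n}"
  show "countable ?W"
    using finite_lists_length_eq[OF finite_verts[OF game]] by (rule countable_finite)
  show "AE xs in distr M (count_space UNIV) (\<lambda>\<omega>. map \<omega> [0..<Suc n]). xs \<in> ?W"
    by (subst AE_distr_iff[OF measurable_prefix]) (auto simp: space_M_iff intro!: AE_I2)
  show "AE xs in measure_pmf (word_pmf n). xs \<in> ?W"
    using set_word_pmf by (auto simp: AE_measure_pmf_iff)
  fix xs assume W: "xs \<in> ?W"
  then have "(\<lambda>\<omega>. map \<omega> [0..<Suc n]) -` {xs} \<inter> space M =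
      {\<omega> \<in> UNIV \<rightarrow>\<^sub>E verts G. \<forall>i<Suc n. \<omega> i = xs ! i}"
    using prefix_eq_iff[of xs "Suc n"] unfolding space_M by auto
  then have "emeasure (distr M (count_space UNIV) (\<lambda>\<omega>. map \<omega> [0..<Suc n])) {xs} =
      emeasure M {\<omega> \<in> UNIV \<rightarrow>\<^sub>E verts G. \<forall>i<Suc n. \<omega> i = xs ! i}"
    by (simp only: emeasure_distr[OF measurable_prefix] sets_count_space Pow_UNIV UNIV_I)
  also have "\<dots> = (\<Prod>i<Suc n. pmf (vertex_pmf G \<pi>\<^sub>1 \<pi>\<^sub>2 v i ((!) xs)) (xs ! i))"
    unfolding emeasure_eq_measure
    using W by (subst measure_path_measure_cylinder[OF game s1 s2 init]) (auto dest: nth_mem)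
  also have "\<dots> = emeasure (measure_pmf (word_pmf n)) {xs}"
    using W by (simp only: emeasure_pmf_single pmf_word_pmf mem_Collect_eq)
  finally show "emeasure (distr M (count_space UNIV) (\<lambda>\<omega>. map \<omega> [0..<Suc n])) {xs} =
      emeasure (measure_pmf (word_pmf n)) {xs}" .
qed simp_all

text \<open>For each \<open>n\<close> the claim concerns a finite prefix, so
  \<open>distr_prefix\<close> reduces it to the support of \<open>word_pmf\<close>; there are
  countably many \<open>n\<close>.\<close>

lemma AE_step: "AE \<omega> in M. \<omega> 0 = v \<and>
    (\<forall>n. \<omega> (Suc n) \<in> set_pmf (step_pmf G \<pi>\<^sub>1 \<pi>\<^sub>2 (map \<omega> [0..<n]) (\<omega> n)))"
proof -
  have AE_prefix: "AE \<omega> in M. P (map \<omega> [0..<Suc n])"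
    if "\<And>xs. xs \<in> set_pmf (word_pmf n) \<Longrightarrow> P xs" for P n
  proof -
    have "AE xs in distr M (count_space UNIV) (\<lambda>\<omega>. map \<omega> [0..<Suc n]). P xs"
      unfolding distr_prefix using that by (auto simp: AE_measure_pmf_iff)
    then show ?thesis
      by (subst (asm) AE_distr_iff[OF measurable_prefix]) simp_all
  qed
  have "AE \<omega> in M. \<omega> 0 = v"
    using AE_prefix[of 0 "\<lambda>xs. xs = [v]"] by simp
  moreover have "AE \<omega> in M. \<omega> (Suc n) \<in> set_pmf (step_pmf G \<pi>\<^sub>1 \<pi>\<^sub>2 (map \<omega> [0..<n]) (\<omega> n))" for n
  proof -
    \<comment> \<open>In a prefix of length \<open>n + 2\<close> the last letter is the new vertex,
      the one before it the current vertex, and the double \<open>butlast\<close> is the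
      history.\<close>
    have "last xs \<in> set_pmf (step_pmf G \<pi>\<^sub>1 \<pi>\<^sub>2 (butlast (butlast xs)) (last (butlast xs)))"
      if "xs \<in> set_pmf (word_pmf (Suc n))" for xs
      using that by auto
    then show ?thesis
      using AE_prefix[of "Suc n" "\<lambda>xs. last xs \<in>
        set_pmf (step_pmf G \<pi>\<^sub>1 \<pi>\<^sub>2 (butlast (butlast xs)) (last (butlast xs)))"]
      by (simp del: word_pmf.simps add: butlast_append)
  qed
  ultimately show ?thesis
    by (simp add: AE_all_countable)
qed

lemma AE_paths: "AE \<omega> in M. \<omega> \<in> paths G"
  using AE_step AE_space
proof eventually_elim
  case (elim \<omega>)
  then have V: "\<omega> k \<in> verts G" for k by (simp add: space_M_iff)
  have "\<omega> (Suc n) \<in> post G (\<omega> n)" for n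
  proof -
    have "map \<omega> [0..<n] \<in> lists (verts G)" using V by auto
    then show ?thesis
      using set_pmf_step[OF game s1 s2 _ V[of n]] elim(1) by blast
  qed
  then show ?case
    using V by (simp add: paths_def post_def)
qed

section \<open>Recurrence of a successor whose probability is bounded below\<close>

lemma AE_infinitely_often_if_bounded_below:
  assumes p: "0 < p" and step: "\<And>h. h \<in> lists (verts G) \<Longrightarrow> p \<le> pmf (step_pmf G \<pi>\<^sub>1 \<pi>\<^sub>2 h w) u"
  shows "AE \<omega> in M. w \<in> inf_visited \<omega> \<longrightarrow> u \<in> inf_visited \<omega>"
proof -
  have *: "AE \<omega> in M. w \<in> inf_visited \<omega> \<longrightarrow> (\<exists>k\<ge>N. \<omega> k = u)" for N
  proof -
    text \<open>\<open>X n\<close> is a nonnegative supermartingale: a bet at every visit to \<open>w\<close> after time \<open>N\<close> that the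
      next vertex is not \<open>u\<close>. It grows without bound on the exceptional event.\<close>
    define f :: "nat \<Rightarrow> 'v \<Rightarrow> 'v \<Rightarrow> real" where
      "f k a b = (if N \<le> k \<and> a = w then if b = u then 0 else 1 + p else 1)" for k a b
    \<comment> \<open>\<open>X n\<close> as a function of the prefix: a word of \<open>n + 1\<close>
      letters has \<open>n\<close> transitions.\<close>
    define Y :: "'v list \<Rightarrow> real" where
      "Y xs = (\<Prod>k<length xs - 1. f k (xs ! k) (xs ! Suc k))" for xs
    define X where "X n \<omega> = (\<Prod>k<n. f k (\<omega> k) (\<omega> (Suc k)))" for n and \<omega> :: "nat \<Rightarrow> 'v"
    have f0: "0 \<le> f k a b" for k a b using p by (simp add: f_def)
    have Y0: "0 \<le> Y xs" for xs by (simp add: Y_def prod_nonneg f0)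
    have YX: "Y (map \<omega> [0..<Suc n]) = X n \<omega>" for n \<omega>
      unfolding Y_def X_def by (intro prod.cong) (auto simp del: upt_Suc)
    have Y_snoc: "Y (xs @ [x]) = Y xs * f n (last xs) x" if len: "length xs = Suc n" for xs x n
    proof -
      have "last xs = xs ! n" using len by (subst last_conv_nth) auto
      then show ?thesis by (simp add: Y_def len nth_append)
    qed
    \<comment> \<open>A factor that is \<open>1 + p\<close> unless \<open>u\<close> follows has
      expectation \<open>(1 + p) * (1 - q)\<close>, where \<open>q \<ge> p\<close> is the
      probability of \<open>u\<close>; this is at most \<open>1 - p^2\<close>.\<close>
    have f_le: "(\<integral>\<^sup>+x. ennreal (f n a x) \<partial>step_pmf G \<pi>\<^sub>1 \<pi>\<^sub>2 h a) \<le> 1"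
      if h: "h \<in> lists (verts G)" for n a h
    proof (cases "N \<le> n \<and> a = w")
      case True
      let ?S = "step_pmf G \<pi>\<^sub>1 \<pi>\<^sub>2 h w"
      have "(\<integral>\<^sup>+x. ennreal (f n a x) \<partial>step_pmf G \<pi>\<^sub>1 \<pi>\<^sub>2 h a) =
          (\<integral>\<^sup>+x. ennreal (1 + p) * indicator (- {u}) x \<partial>?S)"
        using True by (auto simp: f_def indicator_def intro!: nn_integral_cong)
      also have "\<dots> = ennreal (1 + p) * emeasure ?S (- {u})"
        by (simp add: nn_integral_cmult)
      also have "\<dots> = ennreal ((1 + p) * (1 - pmf ?S u))"
        using p measure_pmf.prob_compl[of "{u}" ?S]
        by (simp add: measure_pmf.emeasure_eq_measure Compl_eq_Diff_UNIV measure_pmf_single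
            ennreal_mult pmf_le_1 del: ennreal_plus)
      also have "\<dots> \<le> ennreal ((1 + p) * (1 - p))"
        using p step[OF h] by (intro ennreal_leI mult_left_mono) auto
      also have "\<dots> \<le> 1"
        by (simp add: algebra_simps)
      finally show ?thesis .
    next
      case False
      then show ?thesis by (auto simp: f_def)
    qed
    have Y_le: "(\<integral>\<^sup>+xs. ennreal (Y xs) \<partial>word_pmf n) \<le> 1" for n
    proof (induction n)
      case 0
      then show ?case by (simp add: Y_def)
    next
      case (Suc n)
      let ?S = "\<lambda>xs. step_pmf G \<pi>\<^sub>1 \<pi>\<^sub>2 (butlast xs) (last xs)"
      have "(\<integral>\<^sup>+xs. ennreal (Y xs) \<partial>word_pmf (Suc n)) =
          (\<integral>\<^sup>+xs. \<integral>\<^sup>+x. ennreal (Y (xs @ [x])) \<partial>?S xs \<partial>word_pmf n)"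
        by simp
      also have "\<dots> \<le> (\<integral>\<^sup>+xs. ennreal (Y xs) \<partial>word_pmf n)"
      proof (intro nn_integral_mono_AE, simp add: AE_measure_pmf_iff, intro ballI)
        fix xs assume "xs \<in> set_pmf (word_pmf n)"
        then have len: "length xs = Suc n" and h: "butlast xs \<in> lists (verts G)"
          using set_word_pmf by (auto dest: in_set_butlastD)
        have "(\<integral>\<^sup>+x. ennreal (Y (xs @ [x])) \<partial>?S xs) =
            ennreal (Y xs) * (\<integral>\<^sup>+x. ennreal (f n (last xs) x) \<partial>?S xs)"
          by (simp add: Y_snoc[OF len] ennreal_mult Y0 f0 nn_integral_cmult)
        also have "\<dots> \<le> ennreal (Y xs) * 1"
          by (intro mult_left_mono f_le h) simp
        finally show "(\<integral>\<^sup>+x. ennreal (Y (xs @ [x])) \<partial>?S xs) \<le> ennreal (Y xs)" by simp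
      qed
      finally show ?case using Suc.IH by order
    qed
    have X_meas: "(\<lambda>\<omega>. ennreal (X n \<omega>)) \<in> borel_measurable M" for n
      using measurable_comp[OF measurable_prefix[of "Suc n"], of "\<lambda>xs. ennreal (Y xs)" borel]
      unfolding comp_def YX by simp
    have X_le: "(\<integral>\<^sup>+\<omega>. ennreal (X n \<omega>) \<partial>M) \<le> 1" for n
      using Y_le[of n] nn_integral_distr[OF measurable_prefix[of "Suc n"], of "\<lambda>xs. ennreal (Y xs)"]
      unfolding distr_prefix YX by simp
    \<comment> \<open>Fatou's lemma takes the place of martingale convergence: expectations bounded
      by 1 make the liminf finite almost surely.\<close>
    have "(\<integral>\<^sup>+\<omega>. liminf (\<lambda>n. ennreal (X n \<omega>)) \<partial>M) \<le>
        liminf (\<lambda>n. \<integral>\<^sup>+\<omega>. ennreal (X n \<omega>) \<partial>M)"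
      by (intro nn_integral_liminf X_meas)
    also have "\<dots> \<le> liminf (\<lambda>n::nat. 1)"
      by (intro Liminf_mono always_eventually allI X_le)
    also have "\<dots> = 1"
      by (simp add: Liminf_const)
    finally have "(\<integral>\<^sup>+\<omega>. liminf (\<lambda>n. ennreal (X n \<omega>)) \<partial>M) \<noteq> \<infinity>"
      by (auto simp: top_unique)
    then have "AE \<omega> in M. liminf (\<lambda>n. ennreal (X n \<omega>)) \<noteq> \<infinity>"
      by (intro nn_integral_PInf_AE borel_measurable_liminf X_meas)
    then show ?thesis
    proof eventually_elim
      case (elim \<omega>)
      show ?case
      proof (intro impI, rule ccontr)
        assume w: "w \<in> inf_visited \<omega>" and "\<not> (\<exists>k\<ge>N. \<omega> k = u)"
        then have nu: "\<omega> k \<noteq> u" if "N \<le> k" for k using that by blast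
        \<comment> \<open>The zero branch of \<open>f\<close> never occurs from time
          \<open>N\<close> on. It is decided by the target of the move, hence \<open>nu\<close> at
          \<open>Suc k\<close>.\<close>
        have f_val: "f k (\<omega> k) (\<omega> (Suc k)) = (if N \<le> k \<and> \<omega> k = w then 1 + p else 1)" for k
          using nu[of "Suc k"] by (simp add: f_def)
        have X_Suc: "X (Suc n) \<omega> = X n \<omega> * (if N \<le> n \<and> \<omega> n = w then 1 + p else 1)" for n
          by (simp add: X_def f_val)
        have X0: "0 \<le> X n \<omega>" for n
          by (simp add: X_def prod_nonneg f0)
        have mono: "X m \<omega> \<le> X n \<omega>" if "m \<le> n" for m n
          using that
          by (rule lift_Suc_mono_le[rotated])
            (use p X0 in \<open>auto simp: X_Suc mult_le_cancel_left1 not_less\<close>)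
        \<comment> \<open>\<open>X\<close> is nondecreasing along this path and gains a factor
          \<open>1 + p\<close> at each visit to \<open>w\<close> from time \<open>N\<close> on, so
          infinitely many visits pass every power.\<close>
        have grow: "\<exists>n. (1 + p) ^ j \<le> X n \<omega>" for j
        proof (induction j)
          case 0
          show ?case by (rule exI[of _ 0]) (simp add: X_def)
        next
          case (Suc j)
          then obtain n where n: "(1 + p) ^ j \<le> X n \<omega>" ..
          obtain k where k: "k \<ge> max n N" "\<omega> k = w"
            using w unfolding inf_visited_def INFM_nat_le by blast
          have "(1 + p) ^ j \<le> X k \<omega>"
            using n mono[of n k] k by simp
          then have "(1 + p) ^ Suc j \<le> X (Suc k) \<omega>"
            using p k by (simp add: X_Suc mult.commute)
          then show ?case ..
        qed
        have "filterlim (\<lambda>n. X n \<omega>) at_top sequentially"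
          unfolding filterlim_at_top eventually_sequentially
        proof
          fix B :: real
          obtain j where "B < (1 + p) ^ j"
            using real_arch_pow[of "1 + p" B] p by auto
          moreover obtain n where "(1 + p) ^ j \<le> X n \<omega>" using grow by blast
          ultimately have "B \<le> X n \<omega>" by linarith
          then show "\<exists>n. \<forall>m\<ge>n. B \<le> X m \<omega>" using mono order_trans by blast
        qed
        then have "(\<lambda>n. ennreal (X n \<omega>)) \<longlonglongrightarrow> top"
          by (simp add: ennreal_tendsto_top_eq_at_top)
        then have "liminf (\<lambda>n. ennreal (X n \<omega>)) = top"
          by (intro lim_imp_Liminf) simp_all
        then show False using elim by simp
      qed
    qed
  qed
  \<comment> \<open>A countable intersection over \<open>N\<close> upgrades one visit after each
    bound to infinitely many visits.\<close>
  have "AE \<omega> in M. \<forall>N. w \<in> inf_visited \<omega> \<longrightarrow> (\<exists>k\<ge>N. \<omega> k = u)"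
    using * unfolding AE_all_countable by (intro allI)
  then show ?thesis
    by eventually_elim (auto simp: inf_visited_def INFM_nat_le)
qed

section \<open>Almost sure fairness\<close>

text \<open>Measurability lets the condition that fair plays have measure 1 be read as an almost
  sure statement. It holds because the quantifiers over times are countable and those over vertices
  finite.\<close>

lemma sets_fair_plays: "fair_plays G \<in> sets M"
proof -
  have inf: "Measurable.pred M (\<lambda>\<omega>. a \<in> inf_visited \<omega>)" for a
    unfolding inf_visited_def mem_Collect_eq INFM_nat_le
    by (intro pred_intros_countable pred_intros_logic(3) measurable_const
        measurable_pred_step[of "\<lambda>b c. b = a"]) simp
  have fin: "finite (verts2 G)" "\<And>a. finite (post G a)"
    using game finite_post[OF game] by (auto simp: stochastic_game_def)
  have "Measurable.pred M (\<lambda>\<omega>. \<omega> \<in> paths G \<and>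
      (\<forall>a\<in>verts2 G. a \<in> inf_visited \<omega> \<longrightarrow> (\<forall>b\<in>post G a. b \<in> inf_visited \<omega>)))"
    by (intro pred_intros_logic(3,4) measurable_paths pred_intros_finite(3) fin inf)
  then have "{\<omega> \<in> space M. \<omega> \<in> paths G \<and>
      (\<forall>a\<in>verts2 G. a \<in> inf_visited \<omega> \<longrightarrow> (\<forall>b\<in>post G a. b \<in> inf_visited \<omega>))} \<in> sets M"
    by (rule predE)
  also have "{\<omega> \<in> space M. \<omega> \<in> paths G \<and>
      (\<forall>a\<in>verts2 G. a \<in> inf_visited \<omega> \<longrightarrow> (\<forall>b\<in>post G a. b \<in> inf_visited \<omega>))} = fair_plays G"
    using paths_subset_space by (auto simp: fair_plays_def)
  finally show ?thesis .
qed

text \<open>\<open>fair_plays\<close> constrains Player 2 alone. Probabilistic vertices are fair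
  against all strategies, because the probability \<open>trans_prob G a b\<close> of moving from
  \<open>a\<close> to \<open>b\<close> is the same after every history, and there are finitely many
  such pairs.\<close>

lemma AE_vertsP_fair:
  "AE \<omega> in M. \<forall>a\<in>vertsP G. a \<in> inf_visited \<omega> \<longrightarrow> post G a \<subseteq> inf_visited \<omega>"
proof -
  have "AE \<omega> in M. a \<in> inf_visited \<omega> \<longrightarrow> b \<in> inf_visited \<omega>"
    if "a \<in> vertsP G" "b \<in> post G a" for a b
    by (rule AE_infinitely_often_if_bounded_below[of "trans_prob G a b"])
      (use that in \<open>auto simp: post_def pmf_step_vertsP[OF game]\<close>)
  moreover have "finite (vertsP G)" "\<And>a. finite (post G a)"
    using game finite_post[OF game] by (auto simp: stochastic_game_def)
  ultimately have "AE \<omega> in M. \<forall>a\<in>vertsP G. \<forall>b\<in>post G a. a \<in> inf_visited \<omega> \<longrightarrow> b \<in> inf_visited \<omega>"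
    by (intro AE_finite_allI) simp_all
  then show ?thesis
    by eventually_elim blast
qed

end

lemma uniform_strategy_fair:
  assumes G: "stochastic_game G"
  shows "uniform_strategy G \<in> fair_strategies2 G"
proof -
  have "measure (path_measure G \<pi>\<^sub>1 (uniform_strategy G) v) (fair_plays G) = 1"
    if s: "\<pi>\<^sub>1 \<in> strategies1 G" and v: "v \<in> verts G" for \<pi>\<^sub>1 v
  proof -
    interpret game_play G \<pi>\<^sub>1 "uniform_strategy G" v
      using G s v uniform_strategy(1)[OF G] by unfold_locales
    have "AE \<omega> in M. a \<in> inf_visited \<omega> \<longrightarrow> b \<in> inf_visited \<omega>"
      if ab: "a \<in> verts2 G" "b \<in> post G a" for a b
    proof (rule AE_infinitely_often_if_bounded_below[of "1 / card (post G a)"])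
      show "0 < 1 / real (card (post G a))"
        using ab finite_post[OF G, of a] by (auto simp: card_gt_0_iff)
      \<comment> \<open>\<open>step_pmf\<close> tests \<open>verts1 G\<close> first, so disjointness
        is what selects the branch of Player 2.\<close>
      have "a \<notin> verts1 G" using G ab by (auto simp: stochastic_game_def)
      then show "1 / real (card (post G a)) \<le> pmf (step_pmf G \<pi>\<^sub>1 (uniform_strategy G) h a) b" for h
        using uniform_strategy(3)[OF G ab] ab by (simp add: step_pmf_def)
    qed
    moreover have "finite (verts2 G)" "\<And>a. finite (post G a)"
      using G finite_post[OF G] by (auto simp: stochastic_game_def)
    ultimately have "AE \<omega> in M. \<forall>a\<in>verts2 G. \<forall>b\<in>post G a. a \<in> inf_visited \<omega> \<longrightarrow> b \<in> inf_visited \<omega>"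
      by (intro AE_finite_allI) simp_all
    with AE_paths have "AE \<omega> in M. \<omega> \<in> fair_plays G"
      by eventually_elim (auto simp: fair_plays_def)
    then show ?thesis
      using prob_eq_1[OF sets_fair_plays] by simp
  qed
  then show ?thesis
    using uniform_strategy(1)[OF G] by (simp add: fair_strategies2_def)
qed

section \<open>The cooperative attractor of the terminal vertices\<close>

text \<open>A least fixed point, so that rule induction stands in for the distance to a terminal
  vertex. Player 1 acts as the adversary; at the other vertices one good successor is enough,
  because a fair play returning there infinitely often visits all successors infinitely
  often.\<close>

inductive_set attractor :: "'v game \<Rightarrow> 'v set" for G where
  terminal: "a \<in> terminals G \<Longrightarrow> a \<in> attractor G"
| verts1: "a \<in> verts1 G \<Longrightarrow> (\<And>b. b \<in> post G a \<Longrightarrow> b \<in> attractor G) \<Longrightarrow> a \<in> attractor G"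
| cooperative: "a \<in> verts2 G \<union> vertsP G \<Longrightarrow> b \<in> post G a \<Longrightarrow> b \<in> attractor G \<Longrightarrow> a \<in> attractor G"

text \<open>Infinite recurrence is passed down the attractor: at a Player 1 vertex some successor
  recurs by the pigeonhole principle and all of them are good, elsewhere fairness supplies the good
  one. A mere visit would not do as invariant, since fairness speaks of recurring vertices.\<close>

lemma attractor_inf_visited_terminal:
  assumes "a \<in> attractor G" "a \<in> inf_visited \<omega>" "\<omega> \<in> paths G" "stochastic_game G"
    and fair: "\<And>a. a \<in> verts2 G \<union> vertsP G \<Longrightarrow> a \<in> inf_visited \<omega> \<Longrightarrow> post G a \<subseteq> inf_visited \<omega>"
  shows "\<exists>k. \<omega> k \<in> terminals G"
  using assms(1,2)
proof induction
  case (terminal a)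
  then show ?case by (auto simp: inf_visited_def INFM_nat_le)
next
  case (verts1 a)
  have "infinite {k. \<omega> k = a}"
    using verts1.prems by (simp add: inf_visited_def INFM_iff_infinite)
  moreover have "\<forall>k\<in>{k. \<omega> k = a}. \<exists>b\<in>post G a. \<omega> (Suc k) = b"
    using assms(3) by (auto simp: paths_def post_def)
  ultimately obtain b where b: "b \<in> post G a" and "infinite {k \<in> {k. \<omega> k = a}. \<omega> (Suc k) = b}"
    using pigeonhole_infinite_rel[of "{k. \<omega> k = a}" "post G a" "\<lambda>k b. \<omega> (Suc k) = b"]
      finite_post[OF assms(4)] by blast
  then have "\<exists>\<^sub>\<infinity>k. \<omega> k = a \<and> \<omega> (Suc k) = b"
    by (simp add: INFM_iff_infinite)
  then have "\<exists>\<^sub>\<infinity>k. \<omega> k = b"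
    unfolding INFM_nat_le by (meson le_SucI)
  then show ?case
    using verts1.IH[OF b] by (simp add: inf_visited_def)
next
  case (cooperative a b)
  then show ?case using fair[of a] by blast
qed

text \<open>Outside the attractor a Player 1 vertex has a successor outside it, and any other vertex
  has all its successors outside. Always choosing such a successor avoids the terminal vertices
  forever, contradicting \<open>reach\<close>.\<close>

lemma attractor_eq_verts:
  assumes G: "stochastic_game G"
    and reach: "\<And>v \<pi>\<^sub>1. v \<in> verts G \<Longrightarrow> \<pi>\<^sub>1 \<in> strategies1 G \<Longrightarrow>
      measure (path_measure G \<pi>\<^sub>1 (uniform_strategy G) v) (reach G (terminals G)) = 1"
  shows "verts G \<subseteq> attractor G"
proof (rule subsetI, rule ccontr)
  fix v assume v: "v \<in> verts G" "v \<notin> attractor G"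
  \<comment> \<open>The disjunction gives \<open>SOME\<close> a witness at every vertex of
    \<open>verts G\<close>, also where all successors lie in the attractor, so that
    \<open>\<pi>\<^sub>1\<close> is a legal strategy.\<close>
  define \<pi>\<^sub>1 :: "'a strategy" where
    "\<pi>\<^sub>1 h a = return_pmf (SOME b. b \<in> post G a \<and> (post G a \<subseteq> attractor G \<or> b \<notin> attractor G))" for h a
  have choice: "set_pmf (\<pi>\<^sub>1 h a) \<subseteq> post G a \<and>
      (post G a \<subseteq> attractor G \<or> set_pmf (\<pi>\<^sub>1 h a) \<inter> attractor G = {})" if "a \<in> verts G" for h a
  proof -
    have "\<exists>b. b \<in> post G a \<and> (post G a \<subseteq> attractor G \<or> b \<notin> attractor G)"
    proof (cases "post G a \<subseteq> attractor G")
      case True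
      moreover have "post G a \<noteq> {}" using G that unfolding stochastic_game_def by blast
      ultimately show ?thesis by blast
    qed blast
    from someI_ex[OF this] show ?thesis by (auto simp: \<pi>\<^sub>1_def)
  qed
  then have s: "\<pi>\<^sub>1 \<in> strategies1 G"
    using G by (auto simp: strategies1_def strategy_on_def stochastic_game_def)
  interpret game_play G \<pi>\<^sub>1 "uniform_strategy G" v
    using G s v(1) uniform_strategy(1)[OF G] by unfold_locales
  have "AE \<omega> in M. \<omega> \<notin> reach G (terminals G)"
    using AE_step AE_space
  proof eventually_elim
    case (elim \<omega>)
    then have V: "\<omega> k \<in> verts G" for k by (simp add: space_M_iff)
    have "\<omega> k \<notin> attractor G" for k
    proof (induction k)
      case 0
      then show ?case using elim v by simp
    next
      case (Suc k)
      let ?S = "step_pmf G \<pi>\<^sub>1 (uniform_strategy G) (map \<omega> [0..<k]) (\<omega> k)"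
      have next_in: "\<omega> (Suc k) \<in> set_pmf ?S" using elim by blast
      show ?case
      proof (cases "\<omega> k \<in> verts1 G")
        case True
        then have "\<not> post G (\<omega> k) \<subseteq> attractor G"
          using Suc.IH by (auto intro: attractor.verts1)
        then show ?thesis
          using choice[OF V[of k]] next_in True by (auto simp: step_pmf_def)
      next
        case False
        then have "\<omega> k \<in> verts2 G \<union> vertsP G"
          using V[of k] G by (auto simp: stochastic_game_def)
        moreover have "map \<omega> [0..<k] \<in> lists (verts G)" using V by auto
        then have "\<omega> (Suc k) \<in> post G (\<omega> k)"
          using set_pmf_step[OF game s1 s2 _ V[of k]] next_in by blast
        ultimately show ?thesis
          using Suc.IH by (auto intro: attractor.cooperative)
      qed
    qed
    then show ?case
      by (auto simp: reach_def intro: attractor.terminal)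
  qed
  moreover have "AE \<omega> in M. \<omega> \<in> reach G (terminals G)"
    using reach[OF v(1) s] prob_eq_1[OF sets_reach] by simp
  ultimately have "AE \<omega> in M. False" by eventually_elim simp
  then show False by simp
qed

section \<open>Stopping against all fair strategies and against the uniform one\<close>

theorem theorem1:
  fixes G :: "'v game"
  assumes "stochastic_game G"
  shows "stopping_under_fairness G \<longleftrightarrow>
    (\<forall>v\<in>verts G. \<forall>\<pi>\<^sub>1\<in>strategies1 G.
       measure (path_measure G \<pi>\<^sub>1 (uniform_strategy G) v) (reach G (terminals G)) = 1)"
proof
  assume "stopping_under_fairness G"
  then show "\<forall>v\<in>verts G. \<forall>\<pi>\<^sub>1\<in>strategies1 G.
      measure (path_measure G \<pi>\<^sub>1 (uniform_strategy G) v) (reach G (terminals G)) = 1"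
    using uniform_strategy_fair[OF assms] by (simp add: stopping_under_fairness_def)
next
  assume "\<forall>v\<in>verts G. \<forall>\<pi>\<^sub>1\<in>strategies1 G.
      measure (path_measure G \<pi>\<^sub>1 (uniform_strategy G) v) (reach G (terminals G)) = 1"
  then have attr: "verts G \<subseteq> attractor G"
    using attractor_eq_verts[OF assms] by blast
  show "stopping_under_fairness G"
    unfolding stopping_under_fairness_def
  proof (intro ballI)
    fix \<pi>\<^sub>1 \<pi>\<^sub>2 v
    assume s: "\<pi>\<^sub>1 \<in> strategies1 G" "\<pi>\<^sub>2 \<in> fair_strategies2 G" and v: "v \<in> verts G"
    interpret game_play G \<pi>\<^sub>1 \<pi>\<^sub>2 v
      using assms s v by unfold_locales (auto simp: fair_strategies2_def)
    have "prob (fair_plays G) = 1"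
      using s v by (simp add: fair_strategies2_def)
    then have "AE \<omega> in M. \<omega> \<in> fair_plays G"
      using prob_eq_1[OF sets_fair_plays] by simp
    with AE_vertsP_fair have "AE \<omega> in M. \<omega> \<in> reach G (terminals G)"
    proof eventually_elim
      case (elim \<omega>)
      then have path: "\<omega> \<in> paths G" by (simp add: fair_plays_def)
      \<comment> \<open>There are finitely many vertices, so some vertex recurs; \<open>attr\<close>
        places it in the attractor.\<close>
      then have "\<forall>k\<in>UNIV. \<exists>a\<in>verts G. \<omega> k = a" by (simp add: paths_def)
      then obtain a where a: "a \<in> verts G" "infinite {k. \<omega> k = a}"
        using pigeonhole_infinite_rel[of "UNIV :: nat set" "verts G" "\<lambda>k a. \<omega> k = a"]
          finite_verts[OF assms] by auto
      then have "a \<in> inf_visited \<omega>"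
        by (simp add: inf_visited_def INFM_iff_infinite)
      \<comment> \<open>Fairness at \<open>verts2 G\<close> comes from \<open>fair_plays\<close>, at
        \<open>vertsP G\<close> from \<open>AE_vertsP_fair\<close>.\<close>
      then have "\<exists>k. \<omega> k \<in> terminals G"
        using a(1) attr elim
        by (intro attractor_inf_visited_terminal[OF _ _ path assms]) (auto simp: fair_plays_def)
      then show ?case using path by (simp add: reach_def)
    qed
    then show "measure (path_measure G \<pi>\<^sub>1 \<pi>\<^sub>2 v) (reach G (terminals G)) = 1"
      using prob_eq_1[OF sets_reach] by simp
  qed
qed

end
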